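(* Let $G$ be a finite connected simple non-bipartite graph, let $C_p$ be a cycle in $G$, let $c \in C_p$ be a vertex with $d(c)=2$, and let $b \in \mathrm{N}_G(c)$. Then $\pi_1(\mathcal{N}(G-bc),c)$ is a subgroup of $\pi_1(\mathcal{N}(G),c)$.
   Context: Graphs are finite, undirected, without multiple edges; a simple graph is a graph without looped vertices. $\mathrm{N}_G(v)$ denotes the set of neighbours of a vertex $v$ in $G$, and the degree of a non-looped vertex $v$ is $d(v)=|\mathrm{N}_G(v)|$. The neighbourhood complex $\mathcal{N}(G)$ is the simplicial complex whose simplices are the (nonempty) sets of vertices of $G$ that have a common neighbour in $G$; $\pi_1(\mathcal{N}(G),c)$ is the fundamental group of (the geometric realization of) this complex based at the vertex $c$. $G-bc$ denotes the graph obtained from $G$ by deleting the edge $\{b,c\}$ and keeping all vertices. *)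

theory Defs
  imports
    "HOL-Analysis.Analysis"
    "HOL-Algebra.Group"
    "Graph_Theory.Pair_Digraph"
    "Graph_Theory.Digraph_Component"
begin

section \<open>Graphs\<close>

text \<open>
  Finite simple graphs are the pair graphs of the AFP entry Graph Theory: finite digraphs without
  loops and parallel arcs whose arc set is symmetric, an edge \<open>{u, v}\<close> being the two arcs
  \<open>(u, v)\<close> and \<open>(v, u)\<close>.
\<close>

definition neighbours :: "'a pair_pre_digraph \<Rightarrow> 'a \<Rightarrow> 'a set" where
  "neighbours G v = {w. (v, w) \<in> parcs G}"

definition delete_edge :: "'a pair_pre_digraph \<Rightarrow> 'a \<Rightarrow> 'a \<Rightarrow> 'a pair_pre_digraph" where
  "delete_edge G u v = G\<lparr>parcs := parcs G - {(u, v), (v, u)}\<rparr>"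

definition bipartite :: "'a pair_pre_digraph \<Rightarrow> bool" where
  "bipartite G \<longleftrightarrow>
    (\<exists>U W. pverts G = U \<union> W \<and> U \<inter> W = {} \<and> parcs G \<subseteq> U \<times> W \<union> W \<times> U)"

text \<open>
  A cycle is given by its list of arcs. The directed cycles of the AFP entry include those of
  length two, which run back and forth along one edge and are not cycles of an undirected graph.
\<close>

definition graph_cycle :: "'a pair_pre_digraph \<Rightarrow> ('a \<times> 'a) list \<Rightarrow> bool" where
  "graph_cycle G C \<longleftrightarrow> pre_digraph.cycle (with_proj G) C \<and> 3 \<le> length C"

definition cycle_verts :: "('a \<times> 'a) list \<Rightarrow> 'a set" where
  "cycle_verts C = fst ` set C"


section \<open>The neighbourhood complex and its realization\<close>

definition neighbourhood_complex :: "'a pair_pre_digraph \<Rightarrow> 'a set set" where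
  "neighbourhood_complex G =
    {\<sigma>. \<sigma> \<noteq> {} \<and> \<sigma> \<subseteq> pverts G \<and> (\<exists>v \<in> pverts G. \<sigma> \<subseteq> neighbours G v)}"

text \<open>
  The points of the realization are given by their barycentric coordinates, with the topology of
  pointwise convergence. For a finite complex, the only case in use, this is the usual topology.
\<close>

definition realization :: "'a set set \<Rightarrow> ('a \<Rightarrow> real) set" where
  "realization K = {x. (\<forall>v. 0 \<le> x v) \<and> {v. x v \<noteq> 0} \<in> K \<and> (\<Sum>v | x v \<noteq> 0. x v) = 1}"

definition vertex_point :: "'a \<Rightarrow> 'a \<Rightarrow> real" where
  "vertex_point v = (\<lambda>w. if w = v then 1 else 0)"

lemma vertex_point_in_realization_iff: "vertex_point v \<in> realization K \<longleftrightarrow> {v} \<in> K"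
  by (simp add: realization_def vertex_point_def)

lemma realization_mono: "K \<subseteq> L \<Longrightarrow> realization K \<subseteq> realization L"
  by (auto simp: realization_def)

lemma neighbourhood_complex_delete_edge_subset:
  "neighbourhood_complex (delete_edge G u v) \<subseteq> neighbourhood_complex G"
  by (auto simp: neighbourhood_complex_def delete_edge_def neighbours_def)


section \<open>The fundamental group\<close>

definition loops_at :: "'a::topological_space set \<Rightarrow> 'a \<Rightarrow> (real \<Rightarrow> 'a) set" where
  "loops_at S x = {p. path p \<and> path_image p \<subseteq> S \<and> pathstart p = x \<and> pathfinish p = x}"

definition path_class :: "'a::topological_space set \<Rightarrow> (real \<Rightarrow> 'a) \<Rightarrow> (real \<Rightarrow> 'a) set" where
  "path_class S p = {q. homotopic_paths S p q}"

definition fundamental_group :: "'a::topological_space set \<Rightarrow> 'a \<Rightarrow> (real \<Rightarrow> 'a) set monoid" where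
  "fundamental_group S x =
    \<lparr>carrier = path_class S ` loops_at S x,
     monoid.mult = (\<lambda>A B. \<Union>p \<in> A. \<Union>q \<in> B. path_class S (p +++ q)),
     one = path_class S (\<lambda>_. x)\<rparr>"

lemma path_class_eq_iff:
  assumes "path p" "path_image p \<subseteq> S"
  shows "path_class S p = path_class S q \<longleftrightarrow> homotopic_paths S p q"
  using assms unfolding path_class_def
  by (metis (mono_tags, lifting) Collect_cong homotopic_paths_refl homotopic_paths_sym
      homotopic_paths_trans mem_Collect_eq)

lemma homotopic_paths_right_const:
  assumes "path p" "path_image p \<subseteq> S"
  shows "homotopic_paths S (p +++ (\<lambda>_. pathfinish p)) p"
proof -
  have "continuous_on {0..1} (\<lambda>t::real. min (2 * t) 1)"
    by (intro continuous_intros)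
  then have "homotopic_paths S p (p +++ (\<lambda>_. pathfinish p))"
    using assms
    by (intro homotopic_paths_reparametrize[where f = "\<lambda>t. min (2 * t) 1"])
      (auto simp: joinpaths_def pathfinish_def min_def)
  then show ?thesis
    by (rule homotopic_paths_sym)
qed

lemma homotopic_paths_left_const:
  assumes "path p" "path_image p \<subseteq> S"
  shows "homotopic_paths S ((\<lambda>_. pathstart p) +++ p) p"
proof -
  have "continuous_on {0..1} (\<lambda>t::real. max (2 * t - 1) 0)"
    by (intro continuous_intros)
  then have "homotopic_paths S p ((\<lambda>_. pathstart p) +++ p)"
    using assms
    by (intro homotopic_paths_reparametrize[where f = "\<lambda>t. max (2 * t - 1) 0"])
      (auto simp: joinpaths_def pathstart_def max_def)
  then show ?thesis
    by (rule homotopic_paths_sym)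
qed

lemma homotopic_paths_left_inverse:
  assumes "path p" "path_image p \<subseteq> S"
  shows "homotopic_paths S (reversepath p +++ p) (\<lambda>_. pathfinish p)"
proof -
  define r :: "real \<Rightarrow> real" where "r = reversepath (linepath 0 1) +++ linepath 0 1"
  have "homotopic_paths {0..1} r (linepath 1 1)"
    using homotopic_paths_linv[of "linepath 0 (1::real)" "{0..1}"]
    by (simp add: r_def closed_segment_eq_real_ivl)
  then have "homotopic_paths S (p \<circ> r) (p \<circ> linepath 1 1)"
    by (rule homotopic_paths_continuous_image) (use assms in \<open>auto simp: path_def path_image_def\<close>)
  moreover have "p \<circ> r = reversepath p +++ p"
    by (auto simp: r_def joinpaths_def reversepath_def linepath_def fun_eq_iff)
  moreover have "p \<circ> linepath 1 1 = (\<lambda>_. pathfinish p)"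
    by (auto simp: linepath_def pathfinish_def fun_eq_iff simp flip: distrib_right)
  ultimately show ?thesis
    by simp
qed

lemma fundamental_group_mult:
  assumes "p \<in> loops_at S x" "q \<in> loops_at S x"
  shows "path_class S p \<otimes>\<^bsub>fundamental_group S x\<^esub> path_class S q = path_class S (p +++ q)"
proof -
  have "path_class S (p' +++ q') = path_class S (p +++ q)"
    if "homotopic_paths S p p'" "homotopic_paths S q q'" for p' q'
  proof -
    have "homotopic_paths S (p +++ q) (p' +++ q')"
      using assms that by (intro homotopic_paths_join) (auto simp: loops_at_def)
    moreover have "path (p +++ q)" "path_image (p +++ q) \<subseteq> S"
      using assms by (auto simp: loops_at_def path_image_join)
    ultimately show ?thesis
      by (metis path_class_eq_iff)
  qed
  then have "(\<Union>p' \<in> path_class S p. \<Union>q' \<in> path_class S q. path_class S (p' +++ q')) =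
      (\<Union>p' \<in> path_class S p. \<Union>q' \<in> path_class S q. path_class S (p +++ q))"
    by (intro SUP_cong refl) (simp add: path_class_def[of S p] path_class_def[of S q])
  moreover have "p \<in> path_class S p" "q \<in> path_class S q"
    using assms by (auto simp: path_class_def loops_at_def)
  ultimately show ?thesis
    by (auto simp: fundamental_group_def)
qed

lemma group_fundamental_group:
  assumes "x \<in> S"
  shows "group (fundamental_group S x)"
proof (rule groupI)
  have const: "(\<lambda>_. x) \<in> loops_at S x"
    using assms by (auto simp: loops_at_def path_def path_image_def pathstart_def pathfinish_def)
  have join: "p +++ q \<in> loops_at S x" if "p \<in> loops_at S x" "q \<in> loops_at S x" for p q
    using that by (auto simp: loops_at_def path_image_join)
  have eq: "path_class S p = path_class S q"
    if "homotopic_paths S p q" "p \<in> loops_at S x" for p q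
    using that path_class_eq_iff by (auto simp: loops_at_def)
  have carrier: "carrier (fundamental_group S x) = path_class S ` loops_at S x"
    and one: "\<one>\<^bsub>fundamental_group S x\<^esub> = path_class S (\<lambda>_. x)"
    by (simp_all add: fundamental_group_def)
  show "\<one>\<^bsub>fundamental_group S x\<^esub> \<in> carrier (fundamental_group S x)"
    using const by (simp add: carrier one)
  fix A assume "A \<in> carrier (fundamental_group S x)"
  then obtain p where p: "p \<in> loops_at S x" "A = path_class S p"
    by (auto simp: carrier)
  show "\<one>\<^bsub>fundamental_group S x\<^esub> \<otimes>\<^bsub>fundamental_group S x\<^esub> A = A"
    using p const join homotopic_paths_left_const[of p S]
    by (auto simp: one fundamental_group_mult loops_at_def intro!: eq)
  have rev: "reversepath p \<in> loops_at S x"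
    using p by (auto simp: loops_at_def)
  have "path_class S (reversepath p) \<otimes>\<^bsub>fundamental_group S x\<^esub> A = \<one>\<^bsub>fundamental_group S x\<^esub>"
    using p rev join[OF rev p(1)] homotopic_paths_left_inverse[of p S] eq
    by (auto simp: one fundamental_group_mult loops_at_def)
  then show "\<exists>B \<in> carrier (fundamental_group S x).
      B \<otimes>\<^bsub>fundamental_group S x\<^esub> A = \<one>\<^bsub>fundamental_group S x\<^esub>"
    using rev by (auto simp: carrier)
  fix B assume "B \<in> carrier (fundamental_group S x)"
  then obtain q where q: "q \<in> loops_at S x" "B = path_class S q"
    by (auto simp: carrier)
  show "A \<otimes>\<^bsub>fundamental_group S x\<^esub> B \<in> carrier (fundamental_group S x)"
    using p q join by (auto simp: carrier fundamental_group_mult)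
  fix C assume "C \<in> carrier (fundamental_group S x)"
  then obtain r where r: "r \<in> loops_at S x" "C = path_class S r"
    by (auto simp: carrier)
  have "homotopic_paths S (p +++ (q +++ r)) ((p +++ q) +++ r)"
    using p q r by (intro homotopic_paths_assoc) (auto simp: loops_at_def)
  then have "path_class S (p +++ (q +++ r)) = path_class S ((p +++ q) +++ r)"
    using p q r join eq by blast
  then show "A \<otimes>\<^bsub>fundamental_group S x\<^esub> B \<otimes>\<^bsub>fundamental_group S x\<^esub> C =
      A \<otimes>\<^bsub>fundamental_group S x\<^esub> (B \<otimes>\<^bsub>fundamental_group S x\<^esub> C)"
    using p q r join by (simp add: fundamental_group_mult)
qed

text \<open>
  The map induced by \<open>f\<close>, where \<open>f\<close> maps a space \<open>S\<close> continuously into \<open>T\<close>. For an inclusion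
  \<open>S \<subseteq> T\<close>, \<open>f\<close> is the identity and a class in \<open>S\<close> is sent to the class in \<open>T\<close> containing it.
\<close>

definition fundamental_group_map ::
    "'b::topological_space set \<Rightarrow> ('a::topological_space \<Rightarrow> 'b) \<Rightarrow> (real \<Rightarrow> 'a) set \<Rightarrow> (real \<Rightarrow> 'b) set"
  where "fundamental_group_map T f A = (\<Union>p \<in> A. path_class T (f \<circ> p))"

end

theory Submission
  imports Defs "HOL-Algebra.Coset"
begin

text \<open>
  Write \<open>N(v)\<close> for the set of neighbours of \<open>v\<close> in \<open>G\<close>, let \<open>N(c) = {a, b}\<close>, let \<open>X\<close> and \<open>Y\<close> be the
  neighbourhood complexes of \<open>G - bc\<close> and \<open>G\<close>, and put \<open>B = N(b) - {c}\<close>. Deleting the edge shrinks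
  the neighbourhood of \<open>c\<close> to \<open>{a}\<close> and that of \<open>b\<close> to \<open>B\<close> and changes no other neighbourhood. Hence
  \<open>Y\<close> is \<open>X\<close> together with the edge \<open>{a, b}\<close> and the simplex \<open>B \<union> {c}\<close>. The complex \<open>Y\<close> is built from
  \<open>X\<close> in up to three steps, and the inclusion of each step into the next is injective on fundamental
  groups.

  The first step attaches \<open>{a, b}\<close> and, for a suitable \<open>d \<in> B\<close>, the second one attaches \<open>{c, d}\<close>.
  Attaching an edge never kills a loop (\<open>pi1_injective_attach_edge\<close>), whether the edge joins two
  points of one component, joins two components or has a loose end: the larger space can be mapped
  back by a map that fixes the component of the base point. It squeezes all other components to the
  base point, so that both ends of the edge land in the component of the base point, and then the
  edge can be sent along a path there.

  The third step attaches the simplex \<open>B \<union> {c}\<close>. The only neighbour of \<open>c\<close> in \<open>G - bc\<close> is \<open>a\<close>, so the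
  faces of this simplex that contain \<open>c\<close> and belong to \<open>X\<close> are those in \<open>N(a)\<close>. If \<open>N(a) \<inter> B\<close> is
  nonempty, \<open>d\<close> is chosen in it and \<open>{c, d}\<close> is an edge of \<open>X\<close> anyway; otherwise \<open>{c, d}\<close> is the only
  such face of positive dimension, thanks to the second step. In either case the simplex meets the
  complex built so far in two simplices that have a vertex other than \<open>c\<close> in common, namely \<open>B\<close> and a
  simplex at \<open>c\<close> that contains \<open>d\<close>. The union of two simplices that meet in a face is a retract of
  the simplex on all their vertices, and this retraction extends by the identity
  (\<open>pi1_injective_attach_simplex\<close>).
\<close>


section \<open>Inclusions that are injective on fundamental groups\<close>

text \<open>
  Injectivity is expressed through loops, as triviality of the kernel, so that it composes without
  reference to the group structure.
\<close>

definition pi1_injective :: "'a::topological_space set \<Rightarrow> 'a set \<Rightarrow> 'a \<Rightarrow> bool" where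
  "pi1_injective S T x \<longleftrightarrow> S \<subseteq> T \<and>
    (\<forall>p \<in> loops_at S x. homotopic_paths T p (\<lambda>_. x) \<longrightarrow> homotopic_paths S p (\<lambda>_. x))"

lemma loops_at_mono: "S \<subseteq> T \<Longrightarrow> loops_at S x \<subseteq> loops_at T x"
  by (auto simp: loops_at_def)

lemma pi1_injective_trans:
  "pi1_injective S T x \<Longrightarrow> pi1_injective T U x \<Longrightarrow> pi1_injective S U x"
  unfolding pi1_injective_def using loops_at_mono by blast

text \<open>
  A loop at \<open>x\<close> never leaves the path component of \<open>x\<close> in \<open>S\<close>, so \<open>r\<close> fixes it and carries a
  nullhomotopy in \<open>T\<close> to a nullhomotopy in \<open>S\<close> of the same loop. Because \<open>r\<close> may move the other
  components, such an \<open>r\<close> exists even when \<open>T\<close> connects components of \<open>S\<close> and does not retract onto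
  \<open>S\<close>.
\<close>

lemma pi1_injective_if_retraction:
  assumes "S \<subseteq> T" "continuous_on T r" "r ` T \<subseteq> S"
    and fixed: "\<And>y. path_component S x y \<Longrightarrow> r y = y"
  shows "pi1_injective S T x"
  unfolding pi1_injective_def
proof (intro conjI ballI impI)
  fix p assume p: "p \<in> loops_at S x" and "homotopic_paths T p (\<lambda>_. x)"
  then have "homotopic_paths S (r \<circ> p) (r \<circ> (\<lambda>_. x))"
    using assms by (intro homotopic_paths_continuous_image) auto
  moreover have on_path: "r (p t) = p t" if "t \<in> {0..1}" for t
  proof (rule fixed)
    have "path_component (path_image p) (pathstart p) (p t)"
      using p that path_connected_path_image[of p] pathstart_in_path_image[of p]
      by (auto simp: path_connected_component loops_at_def path_image_def)
    then show "path_component S x (p t)"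
      using p path_component_of_subset by (auto simp: loops_at_def)
  qed
  moreover have "homotopic_paths S p (r \<circ> p)"
    using p on_path by (intro homotopic_paths_eq) (auto simp: loops_at_def)
  moreover have "r x = x"
    using p on_path[of 0] by (auto simp: loops_at_def pathstart_def)
  ultimately show "homotopic_paths S p (\<lambda>_. x)"
    by (auto simp: o_def intro: homotopic_paths_trans)
qed (fact assms)

lemma inclusion_iso_onto_image:
  assumes inj: "pi1_injective S T x" and "x \<in> S"
  defines "\<iota> \<equiv> fundamental_group_map T (\<lambda>y. y)"
    and "P \<equiv> fundamental_group S x" and "Q \<equiv> fundamental_group T x"
  shows "subgroup (\<iota> ` carrier P) Q \<and> \<iota> \<in> iso P (Q\<lparr>carrier := \<iota> ` carrier P\<rparr>)"
proof -
  have sub: "S \<subseteq> T"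
    using inj by (simp add: pi1_injective_def)
  have loops: "p \<in> loops_at T x" if "p \<in> loops_at S x" for p
    using that loops_at_mono[OF sub] by blast
  have P: "carrier P = path_class S ` loops_at S x" "\<one>\<^bsub>P\<^esub> = path_class S (\<lambda>_. x)"
    and Q: "carrier Q = path_class T ` loops_at T x" "\<one>\<^bsub>Q\<^esub> = path_class T (\<lambda>_. x)"
    by (simp_all add: P_def Q_def fundamental_group_def)
  have map: "\<iota> (path_class S p) = path_class T p" if p: "p \<in> loops_at S x" for p
  proof -
    have "path_class T q = path_class T p" if "q \<in> path_class S p" for q
    proof -
      have "homotopic_paths T p q"
        using that homotopic_paths_subset[OF _ sub] by (simp add: path_class_def)
      then have "path_class T p = path_class T q"
        using loops[OF p] by (subst path_class_eq_iff) (auto simp: loops_at_def)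
      then show ?thesis ..
    qed
    moreover have "p \<in> path_class S p"
      using p by (auto simp: path_class_def loops_at_def)
    ultimately have "(\<Union>q \<in> path_class S p. path_class T q) = path_class T p"
      by blast
    then show ?thesis
      by (simp add: \<iota>_def fundamental_group_map_def o_def)
  qed
  have join: "p +++ q \<in> loops_at S x" if "p \<in> loops_at S x" "q \<in> loops_at S x" for p q
    using that by (auto simp: loops_at_def path_image_join)
  interpret group_hom P Q \<iota>
  proof (intro group_hom.intro group_hom_axioms.intro homI)
    show "group P" "group Q"
      using \<open>x \<in> S\<close> sub by (auto simp: P_def Q_def intro: group_fundamental_group)
  next
    fix A B assume "A \<in> carrier P" "B \<in> carrier P"
    then obtain p q where "p \<in> loops_at S x" "A = path_class S p" "q \<in> loops_at S x" "B = path_class S q"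
      by (auto simp: P)
    then show "\<iota> (A \<otimes>\<^bsub>P\<^esub> B) = \<iota> A \<otimes>\<^bsub>Q\<^esub> \<iota> B"
      by (simp add: P_def Q_def map loops join fundamental_group_mult)
  qed (use map loops in \<open>auto simp: P Q\<close>)
  have "inj_on \<iota> (carrier P)"
    unfolding inj_on_one_iff
  proof (intro allI impI)
    fix A assume "A \<in> carrier P" and one: "\<iota> A = \<one>\<^bsub>Q\<^esub>"
    then obtain p where p: "p \<in> loops_at S x" "A = path_class S p"
      by (auto simp: P)
    then have "homotopic_paths T p (\<lambda>_. x)"
      using one map loops[OF p(1)] by (auto simp: Q path_class_eq_iff loops_at_def)
    then have "homotopic_paths S p (\<lambda>_. x)"
      using inj p(1) by (auto simp: pi1_injective_def)
    then show "A = \<one>\<^bsub>P\<^esub>"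
      using p by (auto simp: P path_class_eq_iff loops_at_def)
  qed
  then show ?thesis
    using img_is_subgroup homh by (auto simp: iso_def bij_betw_def hom_def)
qed


section \<open>Realizations of finite complexes\<close>

definition finite_complex :: "'a set set \<Rightarrow> bool" where
  "finite_complex K \<longleftrightarrow> finite K \<and> (\<forall>\<sigma> \<in> K. finite \<sigma> \<and> \<sigma> \<noteq> {} \<and> (\<forall>\<tau> \<subseteq> \<sigma>. \<tau> \<noteq> {} \<longrightarrow> \<tau> \<in> K))"

definition faces :: "'a set \<Rightarrow> 'a set set" where
  "faces \<sigma> = Pow \<sigma> - {{}}"

lemma finite_complexD:
  assumes "finite_complex K"
  shows "finite K" and "\<sigma> \<in> K \<Longrightarrow> finite \<sigma>" and "\<sigma> \<in> K \<Longrightarrow> \<sigma> \<noteq> {}"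
    and "\<sigma> \<in> K \<Longrightarrow> \<tau> \<subseteq> \<sigma> \<Longrightarrow> \<tau> \<noteq> {} \<Longrightarrow> \<tau> \<in> K"
  using assms unfolding finite_complex_def by blast+

lemma finite_complexI:
  assumes "finite K" and "\<And>\<sigma>. \<sigma> \<in> K \<Longrightarrow> finite \<sigma>" and "\<And>\<sigma>. \<sigma> \<in> K \<Longrightarrow> \<sigma> \<noteq> {}"
    and "\<And>\<sigma> \<tau>. \<sigma> \<in> K \<Longrightarrow> \<tau> \<subseteq> \<sigma> \<Longrightarrow> \<tau> \<noteq> {} \<Longrightarrow> \<tau> \<in> K"
  shows "finite_complex K"
  using assms unfolding finite_complex_def by blast

lemma finite_complex_faces: "finite \<sigma> \<Longrightarrow> finite_complex (faces \<sigma>)"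
  by (rule finite_complexI) (auto simp: faces_def finite_subset)

lemma finite_complex_Un: "finite_complex K \<Longrightarrow> finite_complex L \<Longrightarrow> finite_complex (K \<union> L)"
  by (rule finite_complexI) (auto dest: finite_complexD)

lemma realization_Un: "realization (K \<union> L) = realization K \<union> realization L"
  by (auto simp: realization_def)

text \<open>
  A point may be certified by any simplex that carries its coordinates, whereas the definition asks
  for its exact support; this is convenient for maps that may push a coordinate to zero.
\<close>

lemma in_realization_iff:
  assumes "finite_complex K"
  shows "x \<in> realization K \<longleftrightarrow> (\<exists>\<sigma> \<in> K. (\<forall>v. 0 \<le> x v) \<and> (\<forall>v. v \<notin> \<sigma> \<longrightarrow> x v = 0) \<and> sum x \<sigma> = 1)"
proof
  assume "x \<in> realization K"
  then show "\<exists>\<sigma> \<in> K. (\<forall>v. 0 \<le> x v) \<and> (\<forall>v. v \<notin> \<sigma> \<longrightarrow> x v = 0) \<and> sum x \<sigma> = 1"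
    by (intro bexI[of _ "{v. x v \<noteq> 0}"]) (auto simp: realization_def)
next
  assume "\<exists>\<sigma> \<in> K. (\<forall>v. 0 \<le> x v) \<and> (\<forall>v. v \<notin> \<sigma> \<longrightarrow> x v = 0) \<and> sum x \<sigma> = 1"
  then obtain \<sigma> where \<sigma>: "\<sigma> \<in> K" "\<And>v. 0 \<le> x v" "\<And>v. v \<notin> \<sigma> \<Longrightarrow> x v = 0" "sum x \<sigma> = 1"
    by blast
  have fin: "finite \<sigma>" and face: "\<And>\<tau>. \<tau> \<subseteq> \<sigma> \<Longrightarrow> \<tau> \<noteq> {} \<Longrightarrow> \<tau> \<in> K"
    using finite_complexD[OF assms] \<sigma>(1) by blast+
  have sum: "(\<Sum>v | x v \<noteq> 0. x v) = 1"
    using \<sigma>(3,4) fin by (subst sum.mono_neutral_left[of \<sigma>]) auto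
  then have "{v. x v \<noteq> 0} \<noteq> {}"
    by force
  then have "{v. x v \<noteq> 0} \<in> K"
    using \<sigma>(3) by (intro face) auto
  then show "x \<in> realization K"
    using \<sigma>(2) sum by (simp add: realization_def)
qed

lemma realization_faceE:
  assumes "finite_complex K" "x \<in> realization K"
  obtains \<tau> where "\<tau> \<in> K" "\<tau> = {v. x v \<noteq> 0}" "finite \<tau>" "sum x \<tau> = 1" "\<And>v. 0 \<le> x v"
  using assms finite_complexD(2)[OF assms(1)] that[of "{v. x v \<noteq> 0}"]
  by (simp add: realization_def)

lemma simplex_coordinates:
  assumes "x \<in> realization (faces \<sigma>)" "finite \<sigma>"
  shows "0 \<le> x v" and "v \<notin> \<sigma> \<Longrightarrow> x v = 0" and "sum x \<sigma> = 1"
proof -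
  have supp: "{v. x v \<noteq> 0} \<subseteq> \<sigma>" and "(\<Sum>v | x v \<noteq> 0. x v) = 1"
    using assms(1) by (auto simp: realization_def faces_def)
  moreover have "sum x \<sigma> = (\<Sum>v | x v \<noteq> 0. x v)"
    using supp \<open>finite \<sigma>\<close> by (intro sum.mono_neutral_right) auto
  ultimately show "sum x \<sigma> = 1"
    by simp
  show "v \<notin> \<sigma> \<Longrightarrow> x v = 0"
    using supp by blast
  show "0 \<le> x v"
    using assms(1) by (simp add: realization_def)
qed

lemma continuous_on_coordinate: "continuous_on S (\<lambda>x. x v :: real)"
  by (rule continuous_on_subset[OF continuous_on_product_coordinates]) simp

text \<open>
  Closedness allows continuous maps on two subcomplexes to be glued.
\<close>

lemma closed_realization:
  fixes K :: "'a set set"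
  assumes "finite_complex K"
  shows "closed (realization K)"
proof -
  have "realization K =
      (\<Union>\<sigma> \<in> K. {x. (\<forall>v. 0 \<le> x v) \<and> (\<forall>v. v \<notin> \<sigma> \<longrightarrow> x v = 0) \<and> sum x \<sigma> = 1})"
    using in_realization_iff[OF assms] by blast
  moreover have "closed {x. (\<forall>v. 0 \<le> x v) \<and> (\<forall>v. v \<notin> \<sigma> \<longrightarrow> x v = 0) \<and> sum x \<sigma> = (1::real)}"
    for \<sigma> :: "'a set"
    by (intro closed_Collect_conj closed_Collect_all closed_Collect_imp open_Collect_const
        closed_Collect_le closed_Collect_eq continuous_intros continuous_on_coordinate)
  ultimately show ?thesis
    using finite_complexD(1)[OF assms] by (simp add: closed_UN)
qed

text \<open>
  Consequently the path components of a realization are determined by their vertices, and the mass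
  that a point puts on the vertices of a given component is either 0 or 1.
\<close>

lemma path_component_face:
  assumes K: "finite_complex K" and x: "x \<in> realization K" and u: "x u \<noteq> 0"
  shows "path_component (realization K) x (vertex_point u)"
proof -
  define p where "p = (\<lambda>t v. (1 - t) * x v + t * vertex_point u v :: real)"
  obtain \<tau> where \<tau>: "\<tau> \<in> K" "\<tau> = {v. x v \<noteq> 0}" "finite \<tau>" "sum x \<tau> = 1" "\<And>v. 0 \<le> x v"
    using realization_faceE[OF K x] by blast
  have "p t \<in> realization K" if "t \<in> {0..1}" for t
    unfolding in_realization_iff[OF K]
  proof (intro bexI[of _ \<tau>] conjI allI impI)
    show "sum (p t) \<tau> = 1"
      using \<tau> u by (simp add: p_def sum.distrib vertex_point_def flip: sum_distrib_left)
  qed (use that \<tau> u in \<open>auto simp: p_def vertex_point_def\<close>)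
  moreover have "path p"
    unfolding p_def path_def by (intro continuous_intros)
  ultimately show ?thesis
    unfolding path_component_def
    by (intro exI[of _ p]) (auto simp: path_image_def pathstart_def pathfinish_def p_def)
qed


section \<open>Attaching an edge\<close>

text \<open>
  The map back is the simplicial map \<open>g\<close> that sends every vertex outside the component of \<open>c\<close> to \<open>c\<close>,
  extended over the new edge by a path \<open>\<gamma>\<close> between the images of its ends. Neither end has to be a
  vertex of \<open>K\<close>: a new vertex is sent to \<open>c\<close> as well.
\<close>

lemma pi1_injective_attach_edge:
  fixes u w c :: 'a
  assumes K: "finite_complex K" and c: "{c} \<in> K" and "u \<noteq> w"
  shows "pi1_injective (realization K) (realization (K \<union> faces {u, w})) (vertex_point c)"
proof (cases "{u, w} \<in> K")
  case True
  then have "K \<union> faces {u, w} = K"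
    using finite_complexD(4)[OF K] by (auto simp: faces_def)
  then show ?thesis
    by (simp add: pi1_injective_def)
next
  case False
  let ?S = "realization K" and ?E = "realization (faces {u, w})" and ?c = "vertex_point c"
  \<comment> \<open>The mass outside \<open>V\<close> is moved to \<open>c\<close>; the barycentric coordinates of \<open>g x\<close> are affine in those of \<open>x\<close>.\<close>
  define V where "V = {v \<in> \<Union>K. path_component ?S ?c (vertex_point v)}"
  define g where "g x v = (if v \<in> V then x v else 0) + (1 - sum x V) * ?c v" for x :: "'a \<Rightarrow> real" and v
  have fin: "finite V"
    using finite_complexD[OF K] by (auto simp: V_def)
  have cS: "?c \<in> ?S"
    using c by (simp add: vertex_point_in_realization_iff)
  have g_cont: "continuous_on A g" for A
  proof (rule continuous_on_coordinatewise_then_product)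
    fix v
    have "continuous_on A (\<lambda>x. if v \<in> V then x v else 0)"
      by (cases "v \<in> V") (simp_all add: continuous_on_coordinate)
    then show "continuous_on A (\<lambda>x. g x v)"
      unfolding g_def by (intro continuous_intros continuous_on_coordinate)
  qed
  have g_id: "g x = x" if "{v. x v \<noteq> 0} \<subseteq> V" "(\<Sum>v | x v \<noteq> 0. x v) = 1" for x
  proof -
    have "sum x V = 1"
      using that fin by (subst sum.mono_neutral_right[of V "{v. x v \<noteq> 0}"]) auto
    then show ?thesis
      using that by (auto simp: g_def fun_eq_iff)
  qed
  have g_c: "g x = ?c" if "{v. x v \<noteq> 0} \<inter> V = {}" for x
  proof -
    have "sum x V = 0"
      using that by (intro sum.neutral) auto
    then show ?thesis
      using that by (auto simp: g_def fun_eq_iff)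
  qed
  have g_cases: "path_component ?S ?c x \<and> g x = x \<or> \<not> path_component ?S ?c x \<and> g x = ?c"
    if "x \<in> ?S" for x
  proof -
    obtain \<tau> where \<tau>: "\<tau> \<in> K" "\<tau> = {v. x v \<noteq> 0}" "sum x \<tau> = 1"
      using realization_faceE[OF K \<open>x \<in> ?S\<close>] by blast
    then have "\<tau> \<noteq> {}"
      using finite_complexD(3)[OF K] by blast
    have V_iff: "v \<in> V \<longleftrightarrow> path_component ?S ?c x" if "v \<in> \<tau>" for v
      using path_component_face[OF K \<open>x \<in> ?S\<close>, of v] that \<tau>
      by (auto simp: V_def intro: path_component_trans path_component_sym)
    show ?thesis
    proof (cases "path_component ?S ?c x")
      case True
      then have "\<tau> \<subseteq> V" using V_iff by blast
      then show ?thesis using True g_id[of x] \<tau> by auto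
    next
      case False
      then have "\<tau> \<inter> V = {}" using V_iff by blast
      then show ?thesis using False g_c[of x] \<tau> by auto
    qed
  qed
  have g_vertex: "path_component ?S ?c (g (vertex_point v))" for v
  proof (cases "v \<in> V")
    case True
    then have "g (vertex_point v) = vertex_point v"
      by (intro g_id) (auto simp: vertex_point_def)
    then show ?thesis using True by (simp add: V_def)
  next
    case False
    then have "g (vertex_point v) = ?c"
      by (intro g_c) (auto simp: vertex_point_def)
    then show ?thesis using cS by (simp add: path_component_refl)
  qed
  have "path_component ?S (g (vertex_point u)) (g (vertex_point w))"
    using g_vertex path_component_sym path_component_trans by metis
  then obtain \<gamma> where \<gamma>: "path \<gamma>" "path_image \<gamma> \<subseteq> ?S"
      "\<gamma> 0 = g (vertex_point u)" "\<gamma> 1 = g (vertex_point w)"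
    by (auto simp: path_component_def pathstart_def pathfinish_def)
  have E: "finite_complex (faces {u, w})"
    by (simp add: finite_complex_faces)
  have E_coord: "x w \<in> {0..1}" if "x \<in> ?E" for x
  proof -
    have "0 \<le> x u" "0 \<le> x w" "sum x {u, w} = 1"
      using simplex_coordinates[OF that] by blast+
    then show ?thesis
      using \<open>u \<noteq> w\<close> by simp
  qed
  \<comment> \<open>Since \<open>{u, w}\<close> is not a simplex of \<open>K\<close>, the two pieces meet at most in the ends of the edge.\<close>
  have agree: "g x = \<gamma> (x w)" if "x \<in> ?S" "x \<in> ?E" for x
  proof -
    obtain \<tau> where \<tau>: "\<tau> \<in> K" "\<tau> = {v. x v \<noteq> 0}" "sum x \<tau> = 1"
      using realization_faceE[OF K \<open>x \<in> ?S\<close>] by blast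
    have "\<tau> \<in> faces {u, w}"
      using \<open>x \<in> ?E\<close> \<tau> by (simp add: realization_def)
    moreover have "\<tau> \<noteq> {u, w}"
      using False \<tau>(1) by blast
    ultimately have "\<tau> = {u} \<or> \<tau> = {w}"
      unfolding faces_def by blast
    moreover have "x = vertex_point v" if "\<tau> = {v}" for v
    proof
      fix v'
      have "x v = 1"
        using \<tau>(3) that by simp
      moreover have "x v' = 0" if "v' \<noteq> v"
        using \<tau>(2) \<open>\<tau> = {v}\<close> that by blast
      ultimately show "x v' = vertex_point v v'"
        by (simp add: vertex_point_def)
    qed
    ultimately have "x = vertex_point u \<or> x = vertex_point w"
      by blast
    then show ?thesis
    proof
      assume "x = vertex_point u"
      moreover have "vertex_point u w = 0"
        using \<open>u \<noteq> w\<close> by (simp add: vertex_point_def)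
      ultimately show ?thesis
        using \<gamma>(3) by simp
    next
      assume "x = vertex_point w"
      moreover have "vertex_point w w = 1"
        by (simp add: vertex_point_def)
      ultimately show ?thesis
        using \<gamma>(4) by simp
    qed
  qed
  define r where "r x = (if x \<notin> ?S then \<gamma> (x w) else g x)" for x
  show ?thesis
  proof (rule pi1_injective_if_retraction)
    have "continuous_on ?E (\<lambda>x. \<gamma> (x w))"
      by (rule continuous_on_compose2[OF \<gamma>(1)[unfolded path_def] continuous_on_coordinate])
        (use E_coord in blast)
    then have "continuous_on (?E \<union> ?S) r"
      unfolding r_def
      by (intro continuous_on_cases closed_realization K E g_cont) (auto simp: agree)
    then show "continuous_on (realization (K \<union> faces {u, w})) r"
      by (simp add: realization_Un Un_commute)
    have "g x \<in> ?S" if "x \<in> ?S" for x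
      using g_cases[OF that] that cS by auto
    then show "r ` realization (K \<union> faces {u, w}) \<subseteq> ?S"
      using E_coord \<gamma>(2) by (auto simp: r_def realization_Un path_image_def)
  next
    fix y assume y: "path_component ?S ?c y"
    then have "y \<in> ?S"
      using path_component_mem(2) by blast
    then show "r y = y"
      using g_cases y by (auto simp: r_def)
  qed (simp add: realization_Un)
qed


section \<open>Attaching a simplex\<close>

text \<open>
  The simplex \<open>\<sigma> \<union> {w}\<close> meets \<open>K\<close> in the union of \<open>\<sigma>\<close> and \<open>\<rho> \<union> {w}\<close>, that is, in the points \<open>x\<close> where
  the mass \<open>x w\<close> or the total mass on \<open>\<sigma> - \<rho>\<close> vanishes. The retraction lowers both at the same time
  and gives what they lose to the common vertex \<open>d\<close>: every coordinate in \<open>\<sigma> - \<rho>\<close> is lowered by \<open>x w\<close>,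
  and \<open>x w\<close> by the total mass on \<open>\<sigma> - \<rho>\<close>, each truncated at zero. Either \<open>x w\<close> is at most this total,
  and then the coordinate at \<open>w\<close> becomes zero, or it exceeds the total, hence every single
  coordinate in \<open>\<sigma> - \<rho>\<close>, and then all of these become zero. If one of the two masses is zero already,
  the other one is lowered by nothing, so the points of \<open>K\<close> stay fixed.
\<close>

lemma pi1_injective_attach_simplex:
  fixes w d :: 'a
  assumes K: "finite_complex K" and \<sigma>: "\<sigma> \<in> K" and \<rho>: "insert w \<rho> \<in> K" "d \<in> \<rho>" "\<rho> \<subseteq> \<sigma>"
    and "w \<notin> \<sigma>"
    and meet: "\<And>\<tau>. \<tau> \<in> K \<Longrightarrow> w \<in> \<tau> \<Longrightarrow> \<tau> \<subseteq> insert w \<sigma> \<Longrightarrow> \<tau> \<subseteq> insert w \<rho>"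
  shows "pi1_injective (realization K) (realization (K \<union> faces (insert w \<sigma>))) x\<^sub>0"
proof -
  let ?S = "realization K" and ?E = "realization (faces (insert w \<sigma>))"
  define excess where "excess x = max 0 (x w - sum x (\<sigma> - \<rho>))" for x :: "'a \<Rightarrow> real"
  define rest where "rest x = (\<Sum>v \<in> \<sigma> - \<rho>. max 0 (x v - x w))" for x :: "'a \<Rightarrow> real"
  define f where "f x v =
      (if v = w then excess x
       else if v = d then 1 - (excess x + rest x + sum x (\<rho> - {d}))
       else if v \<in> \<rho> then x v
       else if v \<in> \<sigma> then max 0 (x v - x w) else 0)" for x :: "'a \<Rightarrow> real" and v
  have fin: "finite \<sigma>"
    using finite_complexD(2)[OF K \<sigma>] .
  then have fin': "finite \<rho>" "finite (\<sigma> - \<rho>)" "finite (\<rho> - {d})"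
    using \<rho> finite_subset by auto
  have neq: "d \<noteq> w" "w \<notin> \<rho>" "d \<in> \<sigma>"
    using \<rho> \<open>w \<notin> \<sigma>\<close> by auto
  have E: "finite_complex (faces (insert w \<sigma>))"
    using fin by (simp add: finite_complex_faces)
  have f_cont: "continuous_on A f" for A
  proof (rule continuous_on_coordinatewise_then_product)
    fix v
    have "continuous_on A (\<lambda>x. x v)" "continuous_on A (\<lambda>x. max 0 (x v - x w))"
        "continuous_on A excess" "continuous_on A (\<lambda>x. 1 - (excess x + rest x + sum x (\<rho> - {d})))"
      unfolding excess_def rest_def
      by (intro continuous_intros continuous_on_coordinate)+
    then show "continuous_on A (\<lambda>x. f x v)"
      unfolding f_def
      by (cases "v = w"; cases "v = d"; cases "v \<in> \<rho>"; cases "v \<in> \<sigma>") simp_all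
  qed
  have sum_\<sigma>: "sum h \<sigma> = h d + sum h (\<rho> - {d}) + sum h (\<sigma> - \<rho>)" for h :: "'a \<Rightarrow> real"
  proof -
    have "sum h \<sigma> = sum h \<rho> + sum h (\<sigma> - \<rho>)"
      using sum.subset_diff[OF \<rho>(3) fin, of h] by simp
    also have "sum h \<rho> = h d + sum h (\<rho> - {d})"
      using fin' \<rho> by (simp add: sum.remove)
    finally show ?thesis .
  qed
  have E_props: "(\<forall>v. 0 \<le> x v) \<and> (\<forall>v. v \<notin> insert w \<sigma> \<longrightarrow> x v = 0) \<and>
      x w + x d + sum x (\<rho> - {d}) + sum x (\<sigma> - \<rho>) = 1" if "x \<in> ?E" for x
    using simplex_coordinates[OF that] fin \<open>w \<notin> \<sigma>\<close> sum_\<sigma>[of x] by simp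
  have f_S: "f x \<in> ?S" if "x \<in> ?E" for x
  proof -
    note x = E_props[OF that]
    have nonneg: "0 \<le> sum x (\<sigma> - \<rho>)" "0 \<le> sum x (\<rho> - {d})"
      using x by (auto intro: sum_nonneg)
    have exc: "excess x \<le> x w"
      using x nonneg by (simp add: excess_def)
    have "rest x \<le> sum x (\<sigma> - \<rho>)"
      unfolding rest_def by (rule sum_mono) (use x in auto)
    then have pos: "0 \<le> f x v" for v
    proof (cases "v = d")
      case True
      have "0 \<le> x d"
        using x by blast
      then show ?thesis
        using True conjunct2[OF conjunct2[OF x]] exc \<open>rest x \<le> _\<close> neq by (simp add: f_def)
    next
      case False
      then show ?thesis
        using x by (simp add: f_def excess_def)
    qed
    have "sum (f x) (\<rho> - {d}) = sum x (\<rho> - {d})"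
      by (rule sum.cong) (use neq in \<open>auto simp: f_def\<close>)
    moreover have "sum (f x) (\<sigma> - \<rho>) = rest x"
      unfolding rest_def by (rule sum.cong) (use \<rho> \<open>w \<notin> \<sigma>\<close> in \<open>auto simp: f_def\<close>)
    ultimately have sum: "sum (f x) \<sigma> = 1 - excess x"
      unfolding sum_\<sigma> using neq by (simp add: f_def)
    show ?thesis
    proof (cases "x w \<le> sum x (\<sigma> - \<rho>)")
      case True
      then have "excess x = 0"
        by (simp add: excess_def)
      then show ?thesis
        unfolding in_realization_iff[OF K]
        using \<sigma> pos sum \<rho> \<open>w \<notin> \<sigma>\<close> by (intro bexI[of _ \<sigma>]) (auto simp: f_def)
    next
      case False
      have zero: "max 0 (x v - x w) = 0" if "v \<in> \<sigma> - \<rho>" for v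
      proof -
        have "x v \<le> sum x (\<sigma> - \<rho>)"
          using that fin' x by (intro member_le_sum) auto
        then show ?thesis using False by simp
      qed
      then have off: "f x v = 0" if "v \<notin> insert w \<rho>" for v
        using that \<rho> by (auto simp: f_def)
      have "sum (f x) (insert w \<rho>) = sum (f x) (insert w \<sigma>)"
        using \<rho> fin off by (intro sum.mono_neutral_left) auto
      also have "\<dots> = 1"
        using fin \<open>w \<notin> \<sigma>\<close> sum by (simp add: f_def)
      finally show ?thesis
        unfolding in_realization_iff[OF K]
        using \<rho> pos off by (intro bexI[of _ "insert w \<rho>"]) auto
    qed
  qed
  have agree: "f x = x" if "x \<in> ?S" "x \<in> ?E" for x
  proof -
    note x = E_props[OF that(2)]
    have nonneg: "0 \<le> sum x (\<sigma> - \<rho>)"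
      using x by (auto intro: sum_nonneg)
    have "x w = 0 \<or> (\<forall>v \<in> \<sigma> - \<rho>. x v = 0)"
    proof (cases "x w = 0")
      case False
      then have "{v. x v \<noteq> 0} \<subseteq> insert w \<rho>"
        using that by (intro meet) (auto simp: realization_def faces_def)
      then show ?thesis using \<open>w \<notin> \<sigma>\<close> by auto
    qed simp
    then have *: "excess x = x w" "rest x = sum x (\<sigma> - \<rho>)"
        "\<And>v. v \<in> \<sigma> - \<rho> \<Longrightarrow> max 0 (x v - x w) = x v"
      using x nonneg by (auto simp: excess_def rest_def)
    show ?thesis
    proof
      fix v show "f x v = x v"
        using x * by (auto simp: f_def)
    qed
  qed
  define r where "r x = (if x \<notin> ?S then f x else x)" for x
  show ?thesis
  proof (rule pi1_injective_if_retraction)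
    have "continuous_on (?E \<union> ?S) r"
      unfolding r_def
      by (intro continuous_on_cases closed_realization K E f_cont continuous_on_id)
        (auto simp: agree)
    then show "continuous_on (realization (K \<union> faces (insert w \<sigma>))) r"
      by (simp add: realization_Un Un_commute)
    show "r ` realization (K \<union> faces (insert w \<sigma>)) \<subseteq> ?S"
      using f_S by (auto simp: r_def realization_Un)
  next
    fix y assume "path_component ?S x\<^sub>0 y"
    then show "r y = y"
      using path_component_mem(2) by (force simp: r_def)
  qed (simp add: realization_Un)
qed


section \<open>Deleting an edge at a vertex of degree two\<close>

lemma finite_complex_neighbourhood_complex:
  "finite (pverts G) \<Longrightarrow> finite_complex (neighbourhood_complex G)"
  by (rule finite_complexI) (auto simp: neighbourhood_complex_def intro: finite_subset)

text \<open>
  The three attaching steps. If \<open>B\<close> is empty, its simplex adds only the vertex \<open>c\<close>, which is there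
  already, and the first step suffices.
\<close>

lemma pi1_injective_delete_edge:
  assumes "pair_graph G" and N_c: "neighbours G c = {a, b}" and "a \<noteq> b"
  defines "K \<equiv> neighbourhood_complex (delete_edge G b c)"
  shows "{c} \<in> K" and "pi1_injective (realization K) (realization (neighbourhood_complex G)) (vertex_point c)"
proof -
  interpret pair_graph G by fact
  let ?N = "neighbours G" and ?c = "vertex_point c" and ?L = "neighbourhood_complex G"
  define B where "B = ?N b - {c}"
  have sym: "w \<in> ?N v \<longleftrightarrow> v \<in> ?N w" for v w
    using pair_sym_arcs by (auto simp: neighbours_def symmetric_def sym_def)
  have verts: "w \<in> pverts G" if "w \<in> ?N v" for v w
    using that by (auto simp: neighbours_def dest: in_arcsD2)
  have loopfree: "v \<notin> ?N v" for v
    using no_loops' by (auto simp: neighbours_def)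
  have c: "c \<in> ?N a" "c \<in> ?N b" "a \<noteq> c" "b \<noteq> c"
    using N_c loopfree[of c] sym by auto
  have N': "neighbours (delete_edge G b c) v =
      (if v = b then B else if v = c then {a} else ?N v)" for v
    using N_c \<open>a \<noteq> b\<close> c unfolding B_def by (auto simp: neighbours_def delete_edge_def)
  have K_iff: "\<tau> \<in> K \<longleftrightarrow> \<tau> \<noteq> {} \<and>
      (\<tau> \<subseteq> B \<or> \<tau> \<subseteq> {a} \<or> (\<exists>v. v \<noteq> b \<and> v \<noteq> c \<and> \<tau> \<subseteq> ?N v))" for \<tau>
  proof -
    have "\<tau> \<in> K \<longleftrightarrow> \<tau> \<noteq> {} \<and> \<tau> \<subseteq> pverts G \<and>
        (\<exists>v \<in> pverts G. \<tau> \<subseteq> (if v = b then B else if v = c then {a} else ?N v))"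
      by (simp add: K_def neighbourhood_complex_def N') (simp add: delete_edge_def)
    moreover have "b \<in> pverts G" "c \<in> pverts G"
      using c verts sym by blast+
    moreover have "B \<subseteq> pverts G" "a \<in> pverts G"
      using verts N_c by (auto simp: B_def)
    ultimately show ?thesis
      using verts sym \<open>b \<noteq> c\<close> by (auto split: if_splits) (metis subset_iff equals0I)+
  qed
  have L_iff: "\<tau> \<in> ?L \<longleftrightarrow> \<tau> \<noteq> {} \<and> (\<exists>v. \<tau> \<subseteq> ?N v)" for \<tau>
    unfolding neighbourhood_complex_def using verts sym by (auto; metis subset_iff equals0I)
  show cK: "{c} \<in> K"
    using c \<open>a \<noteq> b\<close> by (auto simp: K_iff)
  show "pi1_injective (realization K) (realization ?L) ?c"
  proof -
    have L_eq: "?L = K \<union> faces {a, b} \<union> faces (insert c B)"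
    proof -
      have "insert c B = ?N b"
        using c by (auto simp: B_def)
      then have "(\<exists>v. \<tau> \<subseteq> ?N v) \<longleftrightarrow> \<tau> \<subseteq> insert c B \<or> \<tau> \<subseteq> {a, b} \<or>
          (\<exists>v. v \<noteq> b \<and> v \<noteq> c \<and> \<tau> \<subseteq> ?N v)" for \<tau>
        using N_c by metis
      then show ?thesis
        by (auto simp: set_eq_iff[of ?L] L_iff K_iff faces_def)
    qed
    have fin: "finite (pverts G)" "finite (pverts (delete_edge G b c))"
      using pair_finite_verts by (simp_all add: delete_edge_def)
    then have K: "finite_complex K"
      unfolding K_def by (intro finite_complex_neighbourhood_complex)
    define K\<^sub>1 where "K\<^sub>1 = K \<union> faces {a, b}"
    have K\<^sub>1: "finite_complex K\<^sub>1"
      unfolding K\<^sub>1_def by (intro finite_complex_Un K finite_complex_faces) simp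
    have inj\<^sub>1: "pi1_injective (realization K) (realization K\<^sub>1) ?c"
      unfolding K\<^sub>1_def by (rule pi1_injective_attach_edge[OF K cK \<open>a \<noteq> b\<close>])
    show ?thesis
    proof (cases "B = {}")
      case True
      then have "?L = K\<^sub>1"
        using cK by (auto simp: L_eq K\<^sub>1_def faces_def subset_singleton_iff)
      then show ?thesis
        using inj\<^sub>1 by simp
    next
      case False
      define D where "D = ?N a \<inter> B"
      \<comment> \<open>Taking \<open>d\<close> in \<open>D\<close> where possible makes \<open>\<rho> \<union> {c}\<close> a simplex in both cases: it lies in the
        neighbourhood of \<open>a\<close> if \<open>D\<close> is nonempty and is the edge \<open>{c, d}\<close> otherwise.\<close>
      obtain d where d: "d \<in> B" "D \<noteq> {} \<Longrightarrow> d \<in> D"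
        using False D_def by blast
      define \<rho> where "\<rho> = insert d D"
      define K\<^sub>2 where "K\<^sub>2 = K\<^sub>1 \<union> faces {c, d}"
      have "c \<noteq> d"
        using d by (auto simp: B_def)
      have K\<^sub>2: "finite_complex K\<^sub>2"
        unfolding K\<^sub>2_def by (intro finite_complex_Un K\<^sub>1 finite_complex_faces) simp
      have inj\<^sub>2: "pi1_injective (realization K\<^sub>1) (realization K\<^sub>2) ?c"
        unfolding K\<^sub>2_def
        by (rule pi1_injective_attach_edge[OF K\<^sub>1 _ \<open>c \<noteq> d\<close>]) (simp add: K\<^sub>1_def cK)
      have "pi1_injective (realization K\<^sub>2) (realization (K\<^sub>2 \<union> faces (insert c B))) ?c"
      proof (rule pi1_injective_attach_simplex[OF K\<^sub>2])
        show "B \<in> K\<^sub>2"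
          using False by (simp add: K\<^sub>2_def K\<^sub>1_def K_iff)
        show "insert c \<rho> \<in> K\<^sub>2"
        proof (cases "D = {}")
          case True
          then show ?thesis by (auto simp: \<rho>_def K\<^sub>2_def faces_def)
        next
          case False
          then have "insert c \<rho> \<subseteq> ?N a"
            using d c by (auto simp: \<rho>_def D_def)
          then show ?thesis
            using c \<open>a \<noteq> b\<close> by (auto simp: K\<^sub>2_def K\<^sub>1_def K_iff)
        qed
        show "d \<in> \<rho>" "\<rho> \<subseteq> B" "c \<notin> B"
          using d by (auto simp: \<rho>_def D_def B_def)
        fix \<tau> assume \<tau>: "\<tau> \<in> K\<^sub>2" "c \<in> \<tau>" "\<tau> \<subseteq> insert c B"
        then consider "\<tau> \<in> K" | "\<tau> \<subseteq> {c, d}"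
          using c by (auto simp: K\<^sub>2_def K\<^sub>1_def faces_def)
        then show "\<tau> \<subseteq> insert c \<rho>"
        proof cases
          case 1
          then obtain v where "v \<noteq> b" "v \<noteq> c" "\<tau> \<subseteq> ?N v"
            using \<tau> c by (auto simp: K_iff B_def)
          moreover then have "v = a"
            using \<tau> sym N_c by blast
          ultimately show ?thesis
            using \<tau> by (auto simp: \<rho>_def D_def)
        qed (auto simp: \<rho>_def)
      qed
      moreover have "K\<^sub>2 \<union> faces (insert c B) = ?L"
        using d by (auto simp: L_eq K\<^sub>2_def K\<^sub>1_def faces_def)
      ultimately show ?thesis
        using inj\<^sub>1 inj\<^sub>2 by (auto intro: pi1_injective_trans)
    qed
  qed
qed

theorem theorem2p5:
  fixes G :: "'a pair_pre_digraph" and C :: "('a \<times> 'a) list" and b c :: 'a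
  assumes "pair_graph G"
    and "Digraph_Component.connected (with_proj G)"
    and "\<not> bipartite G"
    and "graph_cycle G C"
    and "c \<in> cycle_verts C"
    and "card (neighbours G c) = 2"
    and "b \<in> neighbours G c"
  defines "X \<equiv> realization (neighbourhood_complex (delete_edge G b c))"
    and "Y \<equiv> realization (neighbourhood_complex G)"
  defines "\<iota> \<equiv> fundamental_group_map Y (\<lambda>x. x)"
    and "P \<equiv> fundamental_group X (vertex_point c)"
    and "Q \<equiv> fundamental_group Y (vertex_point c)"
  shows "subgroup (\<iota> ` carrier P) Q \<and> \<iota> \<in> iso P (Q\<lparr>carrier := \<iota> ` carrier P\<rparr>)"
proof -
  obtain a where "neighbours G c = {a, b}" "a \<noteq> b"
  proof -
    obtain y z where yz: "neighbours G c = {y, z}" "y \<noteq> z"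
      using assms(6) by (auto simp: card_2_iff)
    then consider "b = y" | "b = z"
      using assms(7) by blast
    then show ?thesis
      by cases (use yz that in \<open>auto simp: insert_commute\<close>)
  qed
  then have "{c} \<in> neighbourhood_complex (delete_edge G b c)" "pi1_injective X Y (vertex_point c)"
    using pi1_injective_delete_edge[OF \<open>pair_graph G\<close>] by (auto simp: X_def Y_def)
  then show ?thesis
    unfolding \<iota>_def P_def Q_def
    by (intro inclusion_iso_onto_image) (auto simp: X_def vertex_point_in_realization_iff)
qed

end
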